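(* Let $(X,d)$ be an algebraic metric space and $B$ the set of compact elements of $(X,d)$. Let $\sigma$ be the Scott distance of $(X,d)$. Then for every nonempty subset $A\subseteq X$ and every $x\in X$, $$\sigma(x,A)=\sup_{b\in B}\Big(\big(\inf_{a\in A}d(b,a)\big)\ominus d(b,x)\Big).$$ Hence the Scott distance of $(X,d)$ coincides with the approach distance on $(X,d)$ given by Windels.
   Context: For $a,b\in[0,\infty]$, $a\ominus b=\max\{a-b,0\}$, with conventions $\infty-\infty=0$ and $\infty-a=\infty$ for $a<\infty$. A metric space is a pair $(X,d)$ with $d:X\times X\to[0,\infty]$ such that $d(x,x)=0$ and $d(x,z)\le d(x,y)+d(y,z)$ for all $x,y,z$ (no symmetry, separation or finiteness is required). A net $\{x_i\}_i$ (indexed by a directed set) in $(X,d)$ is forward Cauchy if $\inf_i\sup_{k\ge j\ge i}d(x_j,x_k)=0$. An element $x\in X$ is a Yoneda limit of a forward Cauchy net $\{x_i\}_i$ if $d(x,y)=\inf_i\sup_{j\ge i}d(x_j,y)$ for all $y\in X$. An element $a\in X$ is compact if for each forward Cauchy net $\{x_i\}_i$ with a Yoneda limit $x$, $d(a,x)=\inf_i\sup_{j\ge i}d(a,x_j)$. $(X,d)$ is algebraic if every element of $X$ is a Yoneda limit of a forward Cauchy net consisting of compact elements. An approach distance on a set $X$ is a map $\delta:X\times 2^X\to[0,\infty]$ such that for all $x\in X$ and $A,B\subseteq X$: $\delta(x,\{x\})=0$; $\delta(x,\varnothing)=\infty$; $\delta(x,A\cup B)=\min\{\delta(x,A),\delta(x,B)\}$;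 and $\delta(x,A)\le\delta(x,B)+\sup_{b\in B}\delta(b,A)$. A weight of $(X,d)$ is a function $\phi:X\to[0,\infty]$ with $\phi(x)\le\phi(y)+d(x,y)$ for all $x,y$. A weight $\phi$ is a Scott weight if for every forward Cauchy net $\{x_i\}_i$ and every Yoneda limit $x$ of it, $\inf_i\sup_{j\ge i}\phi(x_j)\ge\phi(x)$. The Scott distance of $(X,d)$ is the approach distance $\sigma(x,A)=\sup\{\phi(x)\mid\phi\text{ is a Scott weight of }(X,d)\text{ and }\phi(a)=0\text{ for all }a\in A\}$ for $x\in X$, $A\subseteq X$. Windels' approach distance is the notion of Scott approach distance that Windels introduced in 2000 for algebraic metric spaces by means of their compact elements; it is the approach distance on $X$ whose value at $(x,A)$, for nonempty $A$, is the right-hand side of the displayed formula (and, as for every approach distance, $\infty$ for $A=\varnothing$). *)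

theory Defs
  imports "HOL-Library.Extended_Nonnegative_Real" "HOL-Library.FuncSet"
begin

text \<open>On type \<^typ>\<open>ennreal\<close> the library has \<open>\<infinity> - \<infinity> = \<infinity>\<close>, whereas the convention needed here is
  \<open>\<infinity> - \<infinity> = 0\<close>. In all other cases library subtraction is \<open>max {a - b, 0}\<close>.\<close>

definition ominus :: "ennreal \<Rightarrow> ennreal \<Rightarrow> ennreal" (infixl \<open>\<ominus>\<close> 65) where
  "a \<ominus> b = (if a = \<infinity> \<and> b = \<infinity> then 0 else a - b)"

text \<open>Metrics are extended, and neither symmetric nor separated; hence neither the class
  \<open>metric_space\<close> nor the locale \<open>Metric_space\<close> of the library applies.\<close>

definition gen_metric_space :: "'a set \<Rightarrow> ('a \<Rightarrow> 'a \<Rightarrow> ennreal) \<Rightarrow> bool" where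
  "gen_metric_space X d \<longleftrightarrow>
     (\<forall>x\<in>X. d x x = 0) \<and> (\<forall>x\<in>X. \<forall>y\<in>X. \<forall>z\<in>X. d x z \<le> d x y + d y z)"

definition directed_set :: "'i set \<Rightarrow> ('i \<Rightarrow> 'i \<Rightarrow> bool) \<Rightarrow> bool" where
  "directed_set I le \<longleftrightarrow> I \<noteq> {} \<and> reflp_on I le \<and> transp_on I le \<and>
     (\<forall>i\<in>I. \<forall>j\<in>I. \<exists>k\<in>I. le i k \<and> le j k)"

definition net_limsup :: "'i set \<Rightarrow> ('i \<Rightarrow> 'i \<Rightarrow> bool) \<Rightarrow> ('i \<Rightarrow> ennreal) \<Rightarrow> ennreal" where
  "net_limsup I le f = (INF i\<in>I. SUP j\<in>{j\<in>I. le i j}. f j)"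

definition forward_cauchy ::
    "'a set \<Rightarrow> ('a \<Rightarrow> 'a \<Rightarrow> ennreal) \<Rightarrow> 'i set \<Rightarrow> ('i \<Rightarrow> 'i \<Rightarrow> bool) \<Rightarrow> ('i \<Rightarrow> 'a) \<Rightarrow> bool" where
  "forward_cauchy X d I le x \<longleftrightarrow> directed_set I le \<and> x \<in> I \<rightarrow> X \<and>
     (INF i\<in>I. SUP (j, k)\<in>{(j, k). j \<in> I \<and> k \<in> I \<and> le i j \<and> le j k}. d (x j) (x k)) = 0"

definition yoneda_limit ::
    "'a set \<Rightarrow> ('a \<Rightarrow> 'a \<Rightarrow> ennreal) \<Rightarrow> 'i set \<Rightarrow> ('i \<Rightarrow> 'i \<Rightarrow> bool) \<Rightarrow> ('i \<Rightarrow> 'a) \<Rightarrow> 'a \<Rightarrow> bool" where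
  "yoneda_limit X d I le x p \<longleftrightarrow>
     p \<in> X \<and> (\<forall>y\<in>X. d p y = net_limsup I le (\<lambda>j. d (x j) y))"

text \<open>A definition cannot quantify over all index types, so nets are quantified over one
  index type that depends only on the type of points. This loses nothing: by
  \<open>forward_cauchy_reindex\<close> below, every forward Cauchy net, whatever its index type, has a
  counterpart indexed by this type with the same values and the same upper limits of all
  functions. The lemmas \<open>compact_element_net\<close>, \<open>algebraicI_net\<close> and \<open>scott_weight_net\<close> then
  remove the restriction from the notions defined here.\<close>

type_synonym 'a net_index = "'a \<times> ('a \<times> 'a) set"

definition compact_element :: "'a set \<Rightarrow> ('a \<Rightarrow> 'a \<Rightarrow> ennreal) \<Rightarrow> 'a \<Rightarrow> bool" where
  "compact_element X d a \<longleftrightarrow> a \<in> X \<and>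
     (\<forall>(I :: 'a net_index set) le x p.
        forward_cauchy X d I le x \<longrightarrow> yoneda_limit X d I le x p \<longrightarrow>
        d a p = net_limsup I le (\<lambda>j. d a (x j)))"

definition algebraic :: "'a set \<Rightarrow> ('a \<Rightarrow> 'a \<Rightarrow> ennreal) \<Rightarrow> bool" where
  "algebraic X d \<longleftrightarrow>
     (\<forall>p\<in>X. \<exists>(I :: 'a net_index set) le x.
        forward_cauchy X d I le x \<and> (\<forall>i\<in>I. compact_element X d (x i)) \<and>
        yoneda_limit X d I le x p)"

definition approach_distance :: "'a set \<Rightarrow> ('a \<Rightarrow> 'a set \<Rightarrow> ennreal) \<Rightarrow> bool" where
  "approach_distance X \<delta> \<longleftrightarrow>
     (\<forall>x\<in>X. \<delta> x {x} = 0) \<and>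
     (\<forall>x\<in>X. \<delta> x {} = \<infinity>) \<and>
     (\<forall>x\<in>X. \<forall>A B. A \<subseteq> X \<longrightarrow> B \<subseteq> X \<longrightarrow> \<delta> x (A \<union> B) = min (\<delta> x A) (\<delta> x B)) \<and>
     (\<forall>x\<in>X. \<forall>A B. A \<subseteq> X \<longrightarrow> B \<subseteq> X \<longrightarrow> \<delta> x A \<le> \<delta> x B + (SUP b\<in>B. \<delta> b A))"

definition weight :: "'a set \<Rightarrow> ('a \<Rightarrow> 'a \<Rightarrow> ennreal) \<Rightarrow> ('a \<Rightarrow> ennreal) \<Rightarrow> bool" where
  "weight X d \<phi> \<longleftrightarrow> (\<forall>x\<in>X. \<forall>y\<in>X. \<phi> x \<le> \<phi> y + d x y)"

definition scott_weight :: "'a set \<Rightarrow> ('a \<Rightarrow> 'a \<Rightarrow> ennreal) \<Rightarrow> ('a \<Rightarrow> ennreal) \<Rightarrow> bool" where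
  "scott_weight X d \<phi> \<longleftrightarrow> weight X d \<phi> \<and>
     (\<forall>(I :: 'a net_index set) le x p.
        forward_cauchy X d I le x \<longrightarrow> yoneda_limit X d I le x p \<longrightarrow>
        net_limsup I le (\<lambda>j. \<phi> (x j)) \<ge> \<phi> p)"

definition scott_distance :: "'a set \<Rightarrow> ('a \<Rightarrow> 'a \<Rightarrow> ennreal) \<Rightarrow> 'a \<Rightarrow> 'a set \<Rightarrow> ennreal" where
  "scott_distance X d x A = (SUP \<phi>\<in>{\<phi>. scott_weight X d \<phi> \<and> (\<forall>a\<in>A. \<phi> a = 0)}. \<phi> x)"

definition windels_distance :: "'a set \<Rightarrow> ('a \<Rightarrow> 'a \<Rightarrow> ennreal) \<Rightarrow> 'a \<Rightarrow> 'a set \<Rightarrow> ennreal" where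
  "windels_distance X d x A =
     (if A = {} then \<infinity>
      else SUP b\<in>{b. compact_element X d b}. (INF a\<in>A. d b a) \<ominus> d b x)"

text \<open>The counterpart of a net \<open>x\<close> is indexed by the pairs \<open>(x i, R i)\<close>, where
  \<open>R i = {(x j, x k) | i \<le> j \<le> k}\<close>, ordered by reverse inclusion of the second component.\<close>

lemma forward_cauchy_reindex:
  fixes X :: "'a set" and I :: "'i set"
  assumes "forward_cauchy X d I le x"
  shows "\<exists>(J :: 'a net_index set) le' y. forward_cauchy X d J le' y \<and> y ` J = x ` I \<and>
    (\<forall>f. net_limsup J le' (\<lambda>j. f (y j)) = net_limsup I le (\<lambda>i. f (x i)))"
proof -
  define R where "R i = {(x j, x k) |j k. j \<in> I \<and> k \<in> I \<and> le i j \<and> le j k}" for i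
  define g where "g i = (x i, R i)" for i
  define le' :: "'a net_index \<Rightarrow> 'a net_index \<Rightarrow> bool" where "le' p q \<longleftrightarrow> snd q \<subseteq> snd p" for p q
  have dir: "directed_set I le" and xX: "x \<in> I \<rightarrow> X"
    and c: "(INF i\<in>I. SUP (j, k)\<in>{(j, k). j \<in> I \<and> k \<in> I \<and> le i j \<and> le j k}. d (x j) (x k)) = 0"
    using assms by (auto simp: forward_cauchy_def)
  have re: "le i i" if "i \<in> I" for i
    using dir that by (auto simp: directed_set_def reflp_on_def)
  have tr: "le i k" if "le i j" "le j k" "i \<in> I" "j \<in> I" "k \<in> I" for i j k
    using dir that unfolding directed_set_def transp_on_def by blast
  have mono: "R j \<subseteq> R i" if "le i j" "i \<in> I" "j \<in> I" for i j
    unfolding R_def using tr that by blast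
  have diag: "(x i, x i) \<in> R i" if "i \<in> I" for i
    unfolding R_def using re that by blast
  have step: "(x j, x k) \<in> R i" if "R j \<subseteq> R i" "R k \<subseteq> R j" "i \<in> I" "j \<in> I" "k \<in> I" for i j k
  proof -
    have "(x k, x k) \<in> R j" using diag[of k] that by blast
    then obtain j' k' where k': "j' \<in> I" "k' \<in> I" "le j j'" "le j' k'" "x k = x k'"
      unfolding R_def by blast
    have "le j k'" using tr k' that by blast
    then have "(x j, x k') \<in> R j" unfolding R_def using re that k' by blast
    then have "(x j, x k) \<in> R j" using k' by simp
    then show ?thesis using that by blast
  qed
  have tail: "fst ` {q \<in> g ` I. le' (g i) q} = x ` {j \<in> I. le i j}" if i: "i \<in> I" for i
  proof (intro equalityI subsetI)
    fix v assume "v \<in> fst ` {q \<in> g ` I. le' (g i) q}"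
    then obtain j where j: "j \<in> I" "R j \<subseteq> R i" "v = x j" by (auto simp: g_def le'_def)
    then have "(v, v) \<in> R i" using diag by blast
    then show "v \<in> x ` {j \<in> I. le i j}" by (auto simp: R_def)
  next
    fix v assume "v \<in> x ` {j \<in> I. le i j}"
    then obtain j where "j \<in> I" "le i j" "v = x j" by blast
    then show "v \<in> fst ` {q \<in> g ` I. le' (g i) q}"
      using mono[of i j] i by (force simp: g_def le'_def)
  qed
  have pairs: "map_prod fst fst ` {(p, q). p \<in> g ` I \<and> q \<in> g ` I \<and> le' (g i) p \<and> le' p q} = R i"
    if i: "i \<in> I" for i
  proof (intro equalityI subsetI)
    fix v assume "v \<in> map_prod fst fst ` {(p, q). p \<in> g ` I \<and> q \<in> g ` I \<and> le' (g i) p \<and> le' p q}"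
    then obtain j k where "j \<in> I" "k \<in> I" "R j \<subseteq> R i" "R k \<subseteq> R j" "v = (x j, x k)"
      by (auto simp: g_def le'_def)
    then show "v \<in> R i" using step i by blast
  next
    fix v assume "v \<in> R i"
    then obtain j k where jk: "j \<in> I" "k \<in> I" "le i j" "le j k" "v = (x j, x k)"
      by (auto simp: R_def)
    then have "v = map_prod fst fst (g j, g k)" "le' (g i) (g j)" "le' (g j) (g k)"
      using mono i by (auto simp: g_def le'_def)
    then show "v \<in> map_prod fst fst ` {(p, q). p \<in> g ` I \<and> q \<in> g ` I \<and> le' (g i) p \<and> le' p q}"
      using jk by blast
  qed
  have "directed_set (g ` I) le'"
    unfolding directed_set_def
  proof (intro conjI ballI)
    show "g ` I \<noteq> {}" using dir by (auto simp: directed_set_def)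
    show "reflp_on (g ` I) le'" by (auto simp: reflp_on_def le'_def)
    show "transp_on (g ` I) le'" by (auto simp: transp_on_def le'_def)
    fix p q assume "p \<in> g ` I" "q \<in> g ` I"
    then obtain i j where ij: "i \<in> I" "j \<in> I" "p = g i" "q = g j" by blast
    then obtain k where "k \<in> I" "le i k" "le j k"
      using dir unfolding directed_set_def by blast
    then show "\<exists>k\<in>g ` I. le' p k \<and> le' q k"
      using ij mono by (auto simp: g_def le'_def)
  qed
  moreover have "fst \<in> g ` I \<rightarrow> X" using xX by (auto simp: g_def)
  moreover have "(INF p\<in>g ` I. SUP (q, r)\<in>{(q, r). q \<in> g ` I \<and> r \<in> g ` I \<and> le' p q \<and> le' q r}.
      d (fst q) (fst r)) = 0"
  proof -
    have "(SUP (q, r)\<in>{(q, r). q \<in> g ` I \<and> r \<in> g ` I \<and> le' (g i) q \<and> le' q r}. d (fst q) (fst r))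
      = (SUP (j, k)\<in>{(j, k). j \<in> I \<and> k \<in> I \<and> le i j \<and> le j k}. d (x j) (x k))" if "i \<in> I" for i
    proof -
      have R: "R i = map_prod x x ` {(j, k). j \<in> I \<and> k \<in> I \<and> le i j \<and> le j k}"
        by (auto simp: R_def)
      have "(SUP v\<in>map_prod fst fst ` {(q, r). q \<in> g ` I \<and> r \<in> g ` I \<and> le' (g i) q \<and> le' q r}.
          case_prod d v) =
        (SUP v\<in>map_prod x x ` {(j, k). j \<in> I \<and> k \<in> I \<and> le i j \<and> le j k}. case_prod d v)"
        using pairs[OF that] R by simp
      then show ?thesis
        by (simp add: image_image case_prod_unfold)
    qed
    then have "(INF p\<in>g ` I. SUP (q, r)\<in>{(q, r). q \<in> g ` I \<and> r \<in> g ` I \<and> le' p q \<and> le' q r}.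
      d (fst q) (fst r)) =
      (INF i\<in>I. SUP (j, k)\<in>{(j, k). j \<in> I \<and> k \<in> I \<and> le i j \<and> le j k}. d (x j) (x k))"
      unfolding image_image by (intro INF_cong refl) simp
    with c show ?thesis by simp
  qed
  ultimately have "forward_cauchy X d (g ` I) le' fst"
    unfolding forward_cauchy_def by blast
  moreover have "fst ` g ` I = x ` I" by (auto simp: g_def image_image)
  moreover have "net_limsup (g ` I) le' (\<lambda>j. f (fst j)) = net_limsup I le (\<lambda>i. f (x i))" for f
  proof -
    have "(SUP q\<in>{q \<in> g ` I. le' (g i) q}. f (fst q)) = (SUP j\<in>{j \<in> I. le i j}. f (x j))"
      if "i \<in> I" for i
      using arg_cong[OF tail[OF that], of "\<lambda>S. SUP v\<in>S. f v"] by (simp add: image_image)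
    then show ?thesis
      unfolding net_limsup_def image_image by (intro INF_cong refl) simp
  qed
  ultimately show ?thesis by blast
qed

lemma compact_element_net:
  assumes "compact_element X d a" "forward_cauchy X d I le x" "yoneda_limit X d I le x p"
  shows "d a p = net_limsup I le (\<lambda>j. d a (x j))"
proof -
  obtain J :: "'a net_index set" and le' y
    where J: "forward_cauchy X d J le' y"
      and l: "\<And>f. net_limsup J le' (\<lambda>j. f (y j)) = net_limsup I le (\<lambda>i. f (x i))"
    using forward_cauchy_reindex[OF assms(2)] by blast
  have "yoneda_limit X d J le' y p"
    using assms(3) l[of "\<lambda>v. d v _"] by (simp add: yoneda_limit_def)
  then show ?thesis
    using assms(1) J unfolding compact_element_def by (simp add: l[of "d a"] flip: l[of "d a"])
qed

lemma algebraicI_net: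
  assumes "\<And>p. p \<in> X \<Longrightarrow> \<exists>(I :: 'i set) le x. forward_cauchy X d I le x \<and>
    (\<forall>i\<in>I. compact_element X d (x i)) \<and> yoneda_limit X d I le x p"
  shows "algebraic X d"
  unfolding algebraic_def
proof
  fix p assume "p \<in> X"
  then obtain I :: "'i set" and le x where I: "forward_cauchy X d I le x"
    "\<forall>i\<in>I. compact_element X d (x i)" "yoneda_limit X d I le x p"
    using assms by blast
  obtain J :: "'a net_index set" and le' y
    where J: "forward_cauchy X d J le' y" "y ` J = x ` I"
      and l: "\<And>f. net_limsup J le' (\<lambda>j. f (y j)) = net_limsup I le (\<lambda>i. f (x i))"
    using forward_cauchy_reindex[OF I(1)] by blast
  have "yoneda_limit X d J le' y p"
    using I(3) l[of "\<lambda>v. d v _"] by (simp add: yoneda_limit_def)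
  moreover have "\<forall>j\<in>J. compact_element X d (y j)"
    using I(2) J(2) by (metis imageE imageI)
  ultimately show "\<exists>(I :: 'a net_index set) le x. forward_cauchy X d I le x \<and>
      (\<forall>i\<in>I. compact_element X d (x i)) \<and> yoneda_limit X d I le x p"
    using J(1) by blast
qed

lemma scott_weight_net:
  assumes "scott_weight X d \<phi>" "forward_cauchy X d I le x" "yoneda_limit X d I le x p"
  shows "net_limsup I le (\<lambda>j. \<phi> (x j)) \<ge> \<phi> p"
proof -
  obtain J :: "'a net_index set" and le' y
    where J: "forward_cauchy X d J le' y"
      and l: "\<And>f. net_limsup J le' (\<lambda>j. f (y j)) = net_limsup I le (\<lambda>i. f (x i))"
    using forward_cauchy_reindex[OF assms(2)] by blast
  have "yoneda_limit X d J le' y p"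
    using assms(3) l[of "\<lambda>v. d v _"] by (simp add: yoneda_limit_def)
  then show ?thesis
    using assms(1) J l[of \<phi>] unfolding scott_weight_def by metis
qed

end

theory Submission imports Defs begin

text \<open>The proof rests on two facts: \<open>a \<ominus> b \<le> c\<close> iff \<open>a \<le> c + b\<close>, including at \<open>\<infinity>\<close>, and upper
  limits along nets are subadditive. For a compact element \<open>b\<close> and a constant \<open>r\<close>, they make
  \<open>\<lambda>x. r \<ominus> d b x\<close> a Scott weight; with \<open>r = inf\<^sub>a d(b, a)\<close> it vanishes on \<open>A\<close>, so the Scott
  distance is at least Windels' distance. Conversely, let \<open>R\<close> be Windels' distance of \<open>x\<close> to
  \<open>A\<close>, let \<open>\<phi>\<close> be a Scott weight vanishing on \<open>A\<close>, and let \<open>x\<close> be the Yoneda limit of compact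
  elements \<open>b\<^sub>j\<close>. Then \<open>\<phi>(b\<^sub>j) \<le> inf\<^sub>a d(b\<^sub>j, a) \<le> R + d(b\<^sub>j, x)\<close>, and passing to upper limits gives
  \<open>\<phi>(x) \<le> R + d(x, x) = R\<close>. The Scott distance is an approach distance because
  Scott weights are closed under \<open>min\<close> and \<open>\<ominus> s\<close>.\<close>

section \<open>Truncated subtraction and upper limits of nets\<close>

text \<open>The convention for \<infinity> - \<infinity> matters here: with library subtraction the
  equivalence would fail for \<open>a = b = \<infinity>\<close> and finite \<open>c\<close>.\<close>

lemma ominus_le_iff: "a \<ominus> b \<le> c \<longleftrightarrow> a \<le> c + b"
  unfolding ominus_def by (auto simp: ennreal_minus_le_iff add.commute)

lemma le_ominus_add: "a \<le> (a \<ominus> b) + b"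
  using ominus_le_iff by blast

lemma directed_set_upper:
  assumes "directed_set I le" "i \<in> I" "j \<in> I"
  obtains k where "k \<in> I" "le i k" "le j k"
  using assms unfolding directed_set_def by blast

lemma directed_set_refl: "directed_set I le \<Longrightarrow> i \<in> I \<Longrightarrow> le i i"
  by (auto simp: directed_set_def reflp_on_def)

lemma directed_set_trans:
  "directed_set I le \<Longrightarrow> le i j \<Longrightarrow> le j k \<Longrightarrow> i \<in> I \<Longrightarrow> j \<in> I \<Longrightarrow> k \<in> I \<Longrightarrow> le i k"
  unfolding directed_set_def transp_on_def by blast

lemma net_limsup_le:
  assumes "i \<in> I" "\<And>j. j \<in> I \<Longrightarrow> le i j \<Longrightarrow> f j \<le> c"
  shows "net_limsup I le f \<le> c"
  unfolding net_limsup_def using assms by (intro INF_lower2[of i] SUP_least) auto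

lemma net_limsup_mono:
  assumes "\<And>j. j \<in> I \<Longrightarrow> f j \<le> g j"
  shows "net_limsup I le f \<le> net_limsup I le g"
  unfolding net_limsup_def using assms by (intro INF_superset_mono SUP_subset_mono order_refl) auto

lemma net_limsup_const:
  assumes "directed_set I le"
  shows "net_limsup I le (\<lambda>_. c) = c"
proof (rule antisym)
  obtain i where "i \<in> I" using assms by (auto simp: directed_set_def)
  then show "net_limsup I le (\<lambda>_. c) \<le> c" by (rule net_limsup_le) simp
  show "c \<le> net_limsup I le (\<lambda>_. c)"
    unfolding net_limsup_def
  proof (rule INF_greatest)
    fix i assume "i \<in> I"
    then show "c \<le> (SUP j\<in>{j \<in> I. le i j}. c)"
      using directed_set_refl[OF assms] by (intro SUP_upper2[of i]) auto
  qed
qed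

lemma net_limsup_add_le:
  assumes dir: "directed_set I le"
  shows "net_limsup I le (\<lambda>j. f j + g j) \<le> net_limsup I le f + net_limsup I le g"
proof -
  let ?L = "net_limsup I le (\<lambda>j. f j + g j)"
  define F where "F i = (SUP j\<in>{j \<in> I. le i j}. f j)" for i
  define G where "G i = (SUP j\<in>{j \<in> I. le i j}. g j)" for i
  have "?L \<le> F i + G j" if ij: "i \<in> I" "j \<in> I" for i j
  proof -
    obtain k where k: "k \<in> I" "le i k" "le j k" using directed_set_upper[OF dir ij] .
    show ?thesis
    proof (rule net_limsup_le[OF k(1)])
      fix l assume "l \<in> I" "le k l"
      then have "le i l" "le j l" using directed_set_trans[OF dir] ij k by blast+
      then show "f l + g l \<le> F i + G j"
        unfolding F_def G_def using \<open>l \<in> I\<close> by (intro add_mono SUP_upper) auto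
    qed
  qed
  \<comment> \<open>Moving one summand to the left by the adjunction lets the infimum over the other
    index be taken alone; doing this twice handles both infima, also at \<infinity>.\<close>
  then have "?L \<ominus> G j \<le> (INF i\<in>I. F i)" if "j \<in> I" for j
    using that by (intro INF_greatest) (simp add: ominus_le_iff)
  then have "?L \<ominus> (INF i\<in>I. F i) \<le> (INF j\<in>I. G j)"
    by (intro INF_greatest) (simp add: ominus_le_iff add.commute)
  then show ?thesis by (simp add: ominus_le_iff add.commute net_limsup_def F_def G_def)
qed

lemma net_limsup_add_const_le:
  assumes "directed_set I le"
  shows "net_limsup I le (\<lambda>j. f j + c) \<le> net_limsup I le f + c"
  using net_limsup_add_le[OF assms, of f "\<lambda>_. c"] by (simp add: net_limsup_const[OF assms])

lemma forward_cauchyD: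
  assumes "forward_cauchy X d I le x" "0 < e"
  obtains i where "i \<in> I" "\<And>j k. j \<in> I \<Longrightarrow> k \<in> I \<Longrightarrow> le i j \<Longrightarrow> le j k \<Longrightarrow> d (x j) (x k) \<le> e"
proof -
  have "(INF i\<in>I. SUP (j, k)\<in>{(j, k). j \<in> I \<and> k \<in> I \<and> le i j \<and> le j k}. d (x j) (x k)) < e"
    using assms by (simp add: forward_cauchy_def)
  then obtain i where i: "i \<in> I"
    "(SUP (j, k)\<in>{(j, k). j \<in> I \<and> k \<in> I \<and> le i j \<and> le j k}. d (x j) (x k)) < e"
    unfolding INF_less_iff by blast
  have "d (x j) (x k) \<le> e" if "j \<in> I" "k \<in> I" "le i j" "le j k" for j k
    using order_trans[OF SUP_upper[of "(j, k)" _ "\<lambda>(j, k). d (x j) (x k)"] less_imp_le[OF i(2)]] that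
    by simp
  with i(1) that show thesis by blast
qed

section \<open>Construction of Scott weights\<close>

lemma scott_weightD: "scott_weight X d \<phi> \<Longrightarrow> x \<in> X \<Longrightarrow> y \<in> X \<Longrightarrow> \<phi> x \<le> \<phi> y + d x y"
  by (simp add: scott_weight_def weight_def)

text \<open>Witness for the value \<infinity> of the Scott distance at the empty set.\<close>

lemma scott_weight_infinity: "scott_weight X d (\<lambda>_. \<infinity>)"
  by (simp add: scott_weight_def weight_def forward_cauchy_def net_limsup_const)

lemma scott_weight_ominus:
  assumes \<phi>: "scott_weight X d \<phi>"
  shows "scott_weight X d (\<lambda>x. \<phi> x \<ominus> s)"
  unfolding scott_weight_def weight_def
proof (intro conjI ballI allI impI)
  fix x y assume "x \<in> X" "y \<in> X"
  then have "\<phi> x \<le> \<phi> y + d x y" by (rule scott_weightD[OF \<phi>])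
  also have "\<dots> \<le> (\<phi> y \<ominus> s) + s + d x y" by (intro add_right_mono le_ominus_add)
  finally show "\<phi> x \<ominus> s \<le> (\<phi> y \<ominus> s) + d x y" by (simp add: ominus_le_iff ac_simps)
next
  fix I :: "'a net_index set" and le x p
  assume fc: "forward_cauchy X d I le x" and lim: "yoneda_limit X d I le x p"
  then have dir: "directed_set I le" by (simp add: forward_cauchy_def)
  have "\<phi> p \<le> net_limsup I le (\<lambda>j. \<phi> (x j))" by (rule scott_weight_net[OF \<phi> fc lim])
  also have "\<dots> \<le> net_limsup I le (\<lambda>j. (\<phi> (x j) \<ominus> s) + s)"
    by (intro net_limsup_mono le_ominus_add)
  also have "\<dots> \<le> net_limsup I le (\<lambda>j. \<phi> (x j) \<ominus> s) + s"
    by (rule net_limsup_add_const_le[OF dir])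
  finally show "\<phi> p \<ominus> s \<le> net_limsup I le (\<lambda>j. \<phi> (x j) \<ominus> s)" by (simp add: ominus_le_iff)
qed

text \<open>For arbitrary functions the upper limit of a minimum can lie below both upper limits, as
  when the two take small values alternately. The forward Cauchy condition rules out such
  oscillation of a weight.\<close>

lemma scott_weight_min:
  assumes \<phi>: "scott_weight X d \<phi>" and \<psi>: "scott_weight X d \<psi>"
  shows "scott_weight X d (\<lambda>x. min (\<phi> x) (\<psi> x))"
  unfolding scott_weight_def weight_def
proof (intro conjI ballI allI impI)
  fix x y assume "x \<in> X" "y \<in> X"
  then show "min (\<phi> x) (\<psi> x) \<le> min (\<phi> y) (\<psi> y) + d x y"
    using scott_weightD[OF \<phi>, of x y] scott_weightD[OF \<psi>, of x y]
    by (auto simp: min_def intro: order_trans)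
next
  fix I :: "'a net_index set" and le x p
  assume fc: "forward_cauchy X d I le x" and lim: "yoneda_limit X d I le x p"
  then have dir: "directed_set I le" and xX: "x \<in> I \<rightarrow> X" by (simp_all add: forward_cauchy_def)
  show "min (\<phi> p) (\<psi> p) \<le> net_limsup I le (\<lambda>j. min (\<phi> (x j)) (\<psi> (x j)))"
    unfolding net_limsup_def
  proof (rule INF_greatest)
    fix i assume i: "i \<in> I"
    define S where "S = (SUP j\<in>{j \<in> I. le i j}. min (\<phi> (x j)) (\<psi> (x j)))"
    have S: "\<phi> (x j) \<le> S \<or> \<psi> (x j) \<le> S" if "j \<in> I" "le i j" for j
      using SUP_upper[of j "{j \<in> I. le i j}" "\<lambda>j. min (\<phi> (x j)) (\<psi> (x j))"] that
      by (auto simp: S_def min_le_iff_disj)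
    show "min (\<phi> p) (\<psi> p) \<le> S"
    proof (cases "\<forall>j\<in>I. \<exists>k\<in>I. le j k \<and> \<phi> (x k) \<le> S")
      case True
      \<comment> \<open>Along a forward Cauchy net a weight that is frequently at most \<open>S\<close> is eventually at
        most \<open>S + e\<close>.\<close>
      have "\<phi> p \<le> S"
      proof (rule ennreal_le_epsilon)
        fix e :: real assume "0 < e"
        then obtain m where m: "m \<in> I"
          "\<And>j k. j \<in> I \<Longrightarrow> k \<in> I \<Longrightarrow> le m j \<Longrightarrow> le j k \<Longrightarrow> d (x j) (x k) \<le> ennreal e"
          using forward_cauchyD[OF fc, of "ennreal e"] by (auto simp: ennreal_less_zero_iff)
        have "net_limsup I le (\<lambda>j. \<phi> (x j)) \<le> S + ennreal e"
        proof (rule net_limsup_le[OF m(1)])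
          fix j assume j: "j \<in> I" "le m j"
          then obtain k where k: "k \<in> I" "le j k" "\<phi> (x k) \<le> S" using True by blast
          \<comment> \<open>The smaller value is taken at the later index \<open>k\<close>, so the
            error is the distance from the earlier to the later point, the one that the forward
            Cauchy condition bounds.\<close>
          have "\<phi> (x j) \<le> \<phi> (x k) + d (x j) (x k)"
            using scott_weightD[OF \<phi>] xX j k by blast
          also have "\<dots> \<le> S + ennreal e" using m(2) j k by (intro add_mono) auto
          finally show "\<phi> (x j) \<le> S + ennreal e" .
        qed
        then show "\<phi> p \<le> S + ennreal e" using scott_weight_net[OF \<phi> fc lim] by simp
      qed
      then show ?thesis by (simp add: min_le_iff_disj)
    next
      case False
      then obtain m where m: "m \<in> I" "\<And>k. k \<in> I \<Longrightarrow> le m k \<Longrightarrow> \<not> \<phi> (x k) \<le> S" by blast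
      \<comment> \<open>Beyond \<open>i\<close> one of the two weights is at most \<open>S\<close>;
        beyond \<open>m\<close> it is not \<phi>. Hence \<psi> is at most \<open>S\<close> beyond
        \<open>n\<close>.\<close>
      obtain n where n: "n \<in> I" "le i n" "le m n" using directed_set_upper[OF dir i m(1)] .
      have "net_limsup I le (\<lambda>j. \<psi> (x j)) \<le> S"
      proof (rule net_limsup_le[OF n(1)])
        fix j assume "j \<in> I" "le n j"
        then have "le i j" "le m j" using directed_set_trans[OF dir] i m(1) n by blast+
        then show "\<psi> (x j) \<le> S" using S m(2) \<open>j \<in> I\<close> by blast
      qed
      then have "\<psi> p \<le> S" using scott_weight_net[OF \<psi> fc lim] by simp
      then show ?thesis by (simp add: min_le_iff_disj)
    qed
  qed
qed

text \<open>The weight inequality is the triangle inequality from \<open>b\<close>. Compactness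
  serves the limit condition, where it replaces the upper limit of \<open>d b (x j)\<close> by
  \<open>d b p\<close>.\<close>

lemma scott_weight_compact:
  assumes gms: "gen_metric_space X d" and b: "compact_element X d b"
  shows "scott_weight X d (\<lambda>x. r \<ominus> d b x)"
  unfolding scott_weight_def weight_def
proof (intro conjI ballI allI impI)
  fix x y assume "x \<in> X" "y \<in> X"
  then have "d b y \<le> d b x + d x y"
    using gms b by (simp add: gen_metric_space_def compact_element_def)
  then have "(r \<ominus> d b y) + d b y \<le> (r \<ominus> d b y) + (d b x + d x y)" by (rule add_left_mono)
  with le_ominus_add have "r \<le> (r \<ominus> d b y) + (d b x + d x y)" by (rule order_trans)
  then show "r \<ominus> d b x \<le> (r \<ominus> d b y) + d x y" by (simp add: ominus_le_iff ac_simps)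
next
  fix I :: "'a net_index set" and le x p
  assume fc: "forward_cauchy X d I le x" and lim: "yoneda_limit X d I le x p"
  then have dir: "directed_set I le" by (simp add: forward_cauchy_def)
  have "r = net_limsup I le (\<lambda>_. r)" by (simp add: net_limsup_const[OF dir])
  also have "\<dots> \<le> net_limsup I le (\<lambda>j. (r \<ominus> d b (x j)) + d b (x j))"
    by (intro net_limsup_mono le_ominus_add)
  also have "\<dots> \<le> net_limsup I le (\<lambda>j. r \<ominus> d b (x j)) + net_limsup I le (\<lambda>j. d b (x j))"
    by (rule net_limsup_add_le[OF dir])
  also have "net_limsup I le (\<lambda>j. d b (x j)) = d b p"
    using compact_element_net[OF b fc lim] by simp
  finally show "r \<ominus> d b p \<le> net_limsup I le (\<lambda>j. r \<ominus> d b (x j))" by (simp add: ominus_le_iff)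
qed

section \<open>The Scott distance as an approach distance\<close>

lemma scott_distance_upper:
  "scott_weight X d \<phi> \<Longrightarrow> (\<And>a. a \<in> A \<Longrightarrow> \<phi> a = 0) \<Longrightarrow> \<phi> x \<le> scott_distance X d x A"
  unfolding scott_distance_def by (rule SUP_upper) simp

lemma scott_distance_least:
  "(\<And>\<phi>. scott_weight X d \<phi> \<Longrightarrow> (\<And>a. a \<in> A \<Longrightarrow> \<phi> a = 0) \<Longrightarrow> \<phi> x \<le> c) \<Longrightarrow>
    scott_distance X d x A \<le> c"
  unfolding scott_distance_def by (rule SUP_least) simp

lemma scott_distance_antimono: "A \<subseteq> B \<Longrightarrow> scott_distance X d x B \<le> scott_distance X d x A"
  by (rule scott_distance_least, rule scott_distance_upper) auto

lemma scott_distance_empty: "scott_distance X d x {} = \<infinity>"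
  using scott_distance_upper[OF scott_weight_infinity, of "{}"] by (simp add: top_unique)

text \<open>If both distances on the right exceeded the left side, two weights would witness this;
  their minimum vanishes on \<open>A \<union> B\<close> and would still exceed the left side at
  \<open>x\<close>.\<close>

lemma scott_distance_Un:
  "scott_distance X d x (A \<union> B) = min (scott_distance X d x A) (scott_distance X d x B)"
proof (rule antisym)
  show "scott_distance X d x (A \<union> B) \<le> min (scott_distance X d x A) (scott_distance X d x B)"
    by (simp add: scott_distance_antimono)
  show "min (scott_distance X d x A) (scott_distance X d x B) \<le> scott_distance X d x (A \<union> B)"
  proof (rule ccontr)
    assume "\<not> ?thesis"
    then have "scott_distance X d x (A \<union> B) < scott_distance X d x A"
      "scott_distance X d x (A \<union> B) < scott_distance X d x B" by (simp_all add: not_le)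
    then obtain \<phi> \<psi> where \<phi>: "scott_weight X d \<phi>" "\<And>a. a \<in> A \<Longrightarrow> \<phi> a = 0"
        "scott_distance X d x (A \<union> B) < \<phi> x"
      and \<psi>: "scott_weight X d \<psi>" "\<And>b. b \<in> B \<Longrightarrow> \<psi> b = 0"
        "scott_distance X d x (A \<union> B) < \<psi> x"
      unfolding scott_distance_def[of _ _ _ A] scott_distance_def[of _ _ _ B] less_SUP_iff by blast
    have "min (\<phi> x) (\<psi> x) \<le> scott_distance X d x (A \<union> B)"
      using \<phi>(2) \<psi>(2) by (intro scott_distance_upper[OF scott_weight_min[OF \<phi>(1) \<psi>(1)]]) auto
    with \<phi>(3) \<psi>(3) show False by (auto simp: min_le_iff_disj)
  qed
qed

lemma scott_distance_triangle:
  "scott_distance X d x A \<le> scott_distance X d x B + (SUP b\<in>B. scott_distance X d b A)"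
proof (rule scott_distance_least)
  define s where "s = (SUP b\<in>B. scott_distance X d b A)"
  fix \<phi> assume \<phi>: "scott_weight X d \<phi>" "\<And>a. a \<in> A \<Longrightarrow> \<phi> a = 0"
  \<comment> \<open>Lowering \<phi> by \<open>s\<close> produces a Scott weight that vanishes on
    \<open>B\<close>, hence a competitor for the distance to \<open>B\<close>.\<close>
  have "\<phi> b \<ominus> s = 0" if "b \<in> B" for b
  proof -
    have "\<phi> b \<le> scott_distance X d b A" using \<phi> by (rule scott_distance_upper)
    also have "\<dots> \<le> s" unfolding s_def using that by (rule SUP_upper)
    finally show ?thesis using ominus_le_iff[of "\<phi> b" s 0] by simp
  qed
  then have "\<phi> x \<ominus> s \<le> scott_distance X d x B"
    by (rule scott_distance_upper[OF scott_weight_ominus[OF \<phi>(1)]])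
  then show "\<phi> x \<le> scott_distance X d x B + (SUP b\<in>B. scott_distance X d b A)"
    by (simp add: ominus_le_iff s_def)
qed

lemma approach_distance_scott_distance: "approach_distance X (scott_distance X d)"
proof -
  have "scott_distance X d x {x} \<le> 0" for x by (rule scott_distance_least) simp
  then show ?thesis
    unfolding approach_distance_def
    using scott_distance_empty scott_distance_Un scott_distance_triangle by auto
qed

text \<open>The axioms evaluate a distance only at points and subsets of \<open>X\<close>, so
  agreement there transfers them from the Scott distance to that of Windels.\<close>

lemma approach_distance_cong:
  assumes "\<And>x A. x \<in> X \<Longrightarrow> A \<subseteq> X \<Longrightarrow> \<delta> x A = \<epsilon> x A" "approach_distance X \<delta>"
  shows "approach_distance X \<epsilon>"
proof -
  have "(SUP b\<in>B. \<delta> b A) = (SUP b\<in>B. \<epsilon> b A)" if "A \<subseteq> X" "B \<subseteq> X" for A B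
    using that assms(1) by (intro SUP_cong) auto
  then show ?thesis
    using assms by (simp add: approach_distance_def)
qed

section \<open>The formula by compact elements\<close>

lemma scott_distance_eq_SUP_compact:
  assumes gms: "gen_metric_space X d" and alg: "algebraic X d" and A: "A \<subseteq> X" and x: "x \<in> X"
  shows "scott_distance X d x A = (SUP b\<in>{b. compact_element X d b}. (INF a\<in>A. d b a) \<ominus> d b x)"
    (is "_ = ?R")
proof (rule antisym)
  obtain I :: "'a net_index set" and le u where fc: "forward_cauchy X d I le u"
    and cpt: "\<And>i. i \<in> I \<Longrightarrow> compact_element X d (u i)" and lim: "yoneda_limit X d I le u x"
    using alg x unfolding algebraic_def by metis
  have dir: "directed_set I le" and uX: "u \<in> I \<rightarrow> X"
    using fc by (simp_all add: forward_cauchy_def)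
  show "scott_distance X d x A \<le> ?R"
  proof (rule scott_distance_least)
    fix \<phi> assume \<phi>: "scott_weight X d \<phi>" "\<And>a. a \<in> A \<Longrightarrow> \<phi> a = 0"
    have le_R: "\<phi> (u j) \<le> d (u j) x + ?R" if j: "j \<in> I" for j
    proof -
      have "\<phi> (u j) \<le> d (u j) a" if "a \<in> A" for a
        using scott_weightD[OF \<phi>(1), of "u j" a] \<phi>(2)[OF that] that A uX j by auto
      then have "\<phi> (u j) \<le> (INF a\<in>A. d (u j) a)" by (rule INF_greatest)
      \<comment> \<open>Being compact, \<open>u j\<close> is itself one of the elements over which
        the supremum \<open>?R\<close> is taken.\<close>
      also have "\<dots> \<le> ?R + d (u j) x"
        unfolding ominus_le_iff[symmetric] using cpt[OF j] by (intro SUP_upper2[of "u j"]) auto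
      finally show ?thesis by (simp add: add.commute)
    qed
    have "\<phi> x \<le> net_limsup I le (\<lambda>j. \<phi> (u j))" by (rule scott_weight_net[OF \<phi>(1) fc lim])
    also have "\<dots> \<le> net_limsup I le (\<lambda>j. d (u j) x + ?R)" by (intro net_limsup_mono le_R)
    also have "\<dots> \<le> net_limsup I le (\<lambda>j. d (u j) x) + ?R" by (rule net_limsup_add_const_le[OF dir])
    \<comment> \<open>The defining equation of the Yoneda limit is tested at the limit point
      itself.\<close>
    also have "net_limsup I le (\<lambda>j. d (u j) x) = d x x"
      using lim x by (simp add: yoneda_limit_def)
    also have "d x x = 0" using gms x by (simp add: gen_metric_space_def)
    finally show "\<phi> x \<le> ?R" by simp
  qed
  show "?R \<le> scott_distance X d x A"
  proof (rule SUP_least)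
    fix b assume "b \<in> {b. compact_element X d b}"
    then have b: "compact_element X d b" by simp
    have "(INF a\<in>A. d b a) \<ominus> d b a = 0" if "a \<in> A" for a
      using ominus_le_iff[of _ "d b a" 0] INF_lower[OF that, of "d b"] by simp
    then show "(INF a\<in>A. d b a) \<ominus> d b x \<le> scott_distance X d x A"
      by (rule scott_distance_upper[OF scott_weight_compact[OF gms b]])
  qed
qed

theorem theorem4p6:
  fixes X :: "'a set" and d :: "'a \<Rightarrow> 'a \<Rightarrow> ennreal"
  assumes "gen_metric_space X d" and "algebraic X d"
    and "B = {b. compact_element X d b}"
  shows "(\<forall>A x. A \<subseteq> X \<longrightarrow> A \<noteq> {} \<longrightarrow> x \<in> X \<longrightarrow>
            scott_distance X d x A = (SUP b\<in>B. (INF a\<in>A. d b a) \<ominus> d b x)) \<and>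
         approach_distance X (windels_distance X d) \<and>
         (\<forall>A x. A \<subseteq> X \<longrightarrow> x \<in> X \<longrightarrow> scott_distance X d x A = windels_distance X d x A)"
proof -
  have eq: "scott_distance X d x A = windels_distance X d x A" if "x \<in> X" "A \<subseteq> X" for x A
    using scott_distance_eq_SUP_compact[OF assms(1,2) that(2,1)]
    by (cases "A = {}") (simp_all add: windels_distance_def scott_distance_empty)
  have "approach_distance X (windels_distance X d)"
    using eq approach_distance_scott_distance by (rule approach_distance_cong)
  with eq show ?thesis
    by (simp add: windels_distance_def assms(3))
qed

end
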